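(* Let $q_0,q_1:\mathbb{R}^n\to\mathbb{R}$ be quadratic functions $q_i(x)=x^\top A_i x+2b_i^\top x+c_i$ with $A_i\in\mathbb{R}^{n\times n}$ symmetric, $b_i\in\mathbb{R}^n$, $c_i\in\mathbb{R}$. Suppose that $A_0$ and $A_1$ both have a negative eigenvalue and that there exists $\gamma^*\geq 0$ with $A_0+\gamma^*A_1\succ 0$. Let $\gamma_-=\min\Gamma$ and $\gamma_+=\max\Gamma$, where $\Gamma=\{\gamma\geq 0: A_0+\gamma A_1\succeq 0\}$ (these exist under the hypotheses). Then $$\operatorname{conv}(\mathcal{S})=\operatorname{conv}(\mathfrak{S})=\mathcal{S}(\gamma_-)\cap\mathcal{S}(\gamma_+).$$ In particular, $$\min_{x\in\mathbb{R}^n}\{q_0(x): q_1(x)\leq 0\}=\min_{x\in\mathbb{R}^n}\max\{q(\gamma_-,x),q(\gamma_+,x)\},$$ where both minima are attained.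
   Context: For $\gamma\in\mathbb{R}$, $q(\gamma,x):=q_0(x)+\gamma q_1(x)$. The sets are $\mathcal{S}:=\{(x,t)\in\mathbb{R}^{n+1}: q_0(x)\leq t,\ q_1(x)\leq 0\}$, $\mathfrak{S}:=\{(x,t)\in\mathbb{R}^{n+1}: q_0(x)\leq t,\ q_1(x)=0\}$, and for $\gamma\geq 0$, $\mathcal{S}(\gamma):=\{(x,t)\in\mathbb{R}^{n+1}: q(\gamma,x)\leq t\}$. $\operatorname{conv}$ denotes convex hull; $\succ 0$ / $\succeq 0$ denote positive definite / positive semidefinite. *)

theory Defs
  imports "HOL-Analysis.Analysis"
begin

definition quad_fun :: "real ^ 'n ^ 'n \<Rightarrow> real ^ 'n \<Rightarrow> real \<Rightarrow> real ^ 'n \<Rightarrow> real" where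
  "quad_fun A b c x = x \<bullet> (A *v x) + 2 * (b \<bullet> x) + c"

definition symmetric_matrix :: "real ^ 'n ^ 'n \<Rightarrow> bool" where
  "symmetric_matrix A \<longleftrightarrow> transpose A = A"

definition eigenvalue :: "real ^ 'n ^ 'n \<Rightarrow> real \<Rightarrow> bool" where
  "eigenvalue A l \<longleftrightarrow> (\<exists>v. v \<noteq> 0 \<and> A *v v = l *\<^sub>R v)"

definition pos_def :: "real ^ 'n ^ 'n \<Rightarrow> bool" where
  "pos_def A \<longleftrightarrow> symmetric_matrix A \<and> (\<forall>x. x \<noteq> 0 \<longrightarrow> x \<bullet> (A *v x) > 0)"

definition pos_semidef :: "real ^ 'n ^ 'n \<Rightarrow> bool" where
  "pos_semidef A \<longleftrightarrow> symmetric_matrix A \<and> (\<forall>x. x \<bullet> (A *v x) \<ge> 0)"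

definition psd_multipliers :: "real ^ 'n ^ 'n \<Rightarrow> real ^ 'n ^ 'n \<Rightarrow> real set" where
  "psd_multipliers A0 A1 = {\<gamma>. \<gamma> \<ge> 0 \<and> pos_semidef (A0 + \<gamma> *\<^sub>R A1)}"

definition aggregate :: "('a \<Rightarrow> real) \<Rightarrow> ('a \<Rightarrow> real) \<Rightarrow> real \<Rightarrow> 'a \<Rightarrow> real" where
  "aggregate q0 q1 \<gamma> x = q0 x + \<gamma> * q1 x"

definition epi_le :: "('a \<Rightarrow> real) \<Rightarrow> ('a \<Rightarrow> real) \<Rightarrow> ('a \<times> real) set" where
  "epi_le q0 q1 = {(x, t). q0 x \<le> t \<and> q1 x \<le> 0}"

definition epi_eq :: "('a \<Rightarrow> real) \<Rightarrow> ('a \<Rightarrow> real) \<Rightarrow> ('a \<times> real) set" where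
  "epi_eq q0 q1 = {(x, t). q0 x \<le> t \<and> q1 x = 0}"

definition epi_aggregate :: "('a \<Rightarrow> real) \<Rightarrow> ('a \<Rightarrow> real) \<Rightarrow> real \<Rightarrow> ('a \<times> real) set" where
  "epi_aggregate q0 q1 \<gamma> = {(x, t). aggregate q0 q1 \<gamma> x \<le> t}"

end

theory Submission
  imports Defs
begin

text \<open>
  Both aggregated functions are convex, which gives the inclusion of the hulls in the
  intersection. At an extreme multiplier the form \<open>A0 + \<gamma> A1\<close> has an isotropic vector \<open>v\<close>, so
  \<open>q(\<gamma>, \<cdot>)\<close> is affine along \<open>v\<close>, whereas \<open>q1\<close> is strictly convex (for the smallest multiplier)
  or strictly concave (for the largest) along \<open>v\<close>. Hence a point of the intersection with
  \<open>q1 x < 0\<close> (respectively \<open>q1 x > 0\<close>) lies between two zeros of \<open>q1\<close> on its line in direction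
  \<open>v\<close>; moving \<open>t\<close> along with the affine function lifts these zeros to points of \<open>epi_eq\<close>
  with \<open>(x, t)\<close> on the segment joining them.
\<close>

section \<open>Quadratic functions on lines and under aggregation\<close>

lemma quad_form_add_scaleR:
  fixes A B :: "real ^ 'n ^ 'n"
  shows "x \<bullet> ((A + \<gamma> *\<^sub>R B) *v x) = x \<bullet> (A *v x) + \<gamma> * (x \<bullet> (B *v x))"
  by (simp add: matrix_vector_mult_add_rdistrib inner_add_right flip: scaleR_matrix_vector_assoc)

text \<open>Everything below happens on lines. The coefficient of \<open>\<alpha>\<^sup>2\<close> is
  the form at \<open>v\<close>, so the function is affine along a direction exactly when that
  direction is isotropic.\<close>

lemma quad_fun_along_line:
  "quad_fun A b c (x + \<alpha> *\<^sub>R v) =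
     quad_fun A b c x + \<alpha> * (x \<bullet> (A *v v) + v \<bullet> (A *v x) + 2 * (b \<bullet> v)) + \<alpha>\<^sup>2 * (v \<bullet> (A *v v))"
  by (simp add: quad_fun_def matrix_vector_right_distrib matrix_vector_mult_scaleR inner_add_left
      inner_add_right algebra_simps power2_eq_square)

lemma continuous_on_quad_fun [continuous_intros]: "continuous_on S (quad_fun A b c)"
proof -
  have "quad_fun A b c = (\<lambda>x. x \<bullet> (A *v x) + 2 * (b \<bullet> x) + c)"
    by (simp add: quad_fun_def fun_eq_iff)
  thus ?thesis
    by (auto intro!: continuous_intros matrix_vector_mult_linear_continuous_on)
qed

lemma aggregate_quad_fun:
  "aggregate (quad_fun A0 b0 c0) (quad_fun A1 b1 c1) \<gamma> =
     quad_fun (A0 + \<gamma> *\<^sub>R A1) (b0 + \<gamma> *\<^sub>R b1) (c0 + \<gamma> * c1)"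
  unfolding fun_eq_iff aggregate_def quad_fun_def quad_form_add_scaleR
  by (simp add: inner_add_left distrib_left)

lemma symmetric_matrix_add_scaleR:
  "symmetric_matrix A \<Longrightarrow> symmetric_matrix B \<Longrightarrow> symmetric_matrix (A + \<gamma> *\<^sub>R B)"
  by (simp add: symmetric_matrix_def transpose_def vec_eq_iff)

section \<open>Definiteness, growth of positive definite quadratics, existence of minimizers\<close>

lemma pos_def_imp_pos_semidef:
  assumes "pos_def A"
  shows "pos_semidef A"
proof -
  have "0 \<le> x \<bullet> (A *v x)" for x
    using assms by (cases "x = 0") (auto simp: pos_def_def less_imp_le)
  thus ?thesis
    using assms by (simp add: pos_def_def pos_semidef_def)
qed

lemma negative_eigenvalue_negative_direction:
  assumes "l < 0" "eigenvalue A l"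
  obtains v where "v \<bullet> (A *v v) < 0"
proof -
  obtain v where v: "v \<noteq> 0" "A *v v = l *\<^sub>R v"
    using assms unfolding eigenvalue_def by blast
  hence "v \<bullet> (A *v v) < 0"
    using assms(1) by (simp add: mult_neg_pos)
  thus ?thesis by (rule that)
qed

text \<open>The constant is the minimum of the form over the compact unit sphere, positive because
  it is attained at a nonzero vector. Homogeneity of degree two carries the bound to all
  \<open>x\<close>.\<close>

lemma pos_def_lower_bound:
  fixes A :: "real ^ 'n ^ 'n"
  assumes "pos_def A"
  obtains m where "m > 0" "\<And>x. m * (norm x)\<^sup>2 \<le> x \<bullet> (A *v x)"
proof -
  have "sphere (0::real^'n) 1 \<noteq> {}"
    by simp
  moreover have "continuous_on (sphere 0 1) (\<lambda>x. x \<bullet> (A *v x))"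
    by (intro continuous_intros matrix_vector_mult_linear_continuous_on)
  ultimately obtain u where u: "norm u = 1"
      and min: "\<And>y. norm y = 1 \<Longrightarrow> u \<bullet> (A *v u) \<le> y \<bullet> (A *v y)"
    using continuous_attains_inf[of "sphere 0 1" "\<lambda>x. x \<bullet> (A *v x)"] by auto
  show ?thesis
  proof
    show "u \<bullet> (A *v u) > 0"
      using assms u unfolding pos_def_def by (metis norm_zero zero_neq_one)
    show "u \<bullet> (A *v u) * (norm x)\<^sup>2 \<le> x \<bullet> (A *v x)" for x
    proof (cases "x = 0")
      case False
      define y where "y = x /\<^sub>R norm x"
      have x: "x = norm x *\<^sub>R y" and "norm y = 1"
        using False by (simp_all add: y_def)
      have "x \<bullet> (A *v x) = (norm x)\<^sup>2 * (y \<bullet> (A *v y))"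
        by (subst (1 2) x) (simp add: matrix_vector_mult_scaleR power2_eq_square)
      thus ?thesis
        using min[OF \<open>norm y = 1\<close>] by (simp add: mult.commute mult_right_mono)
    qed simp
  qed
qed

text \<open>The form of \<open>A\<close> grows at least like \<open>m\<close> times the squared
  norm, that of \<open>B\<close> at most like \<open>K\<close> times it, so every perturbation of
  size up to \<open>m / K\<close> is absorbed. It serves to show that a multiplier with a positive
  definite form cannot be extreme.\<close>

lemma pos_semidef_perturbation:
  fixes A B :: "real ^ 'n ^ 'n"
  assumes "pos_def A" "symmetric_matrix B"
  obtains e where "e > 0" "\<And>\<delta>. \<bar>\<delta>\<bar> \<le> e \<Longrightarrow> pos_semidef (A + \<delta> *\<^sub>R B)"
proof -
  obtain m where m: "m > 0" "\<And>x. m * (norm x)\<^sup>2 \<le> x \<bullet> (A *v x)"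
    using pos_def_lower_bound[OF assms(1)] by blast
  obtain K where K: "K > 0" "\<And>x. norm (B *v x) \<le> norm x * K"
    using bounded_linear.pos_bounded[OF matrix_vector_mul_bounded_linear[of B]] by blast
  have B: "\<bar>x \<bullet> (B *v x)\<bar> \<le> K * (norm x)\<^sup>2" for x
  proof -
    have "\<bar>x \<bullet> (B *v x)\<bar> \<le> norm x * norm (B *v x)"
      by (rule Cauchy_Schwarz_ineq2)
    also have "\<dots> \<le> norm x * (norm x * K)"
      by (intro mult_left_mono K) simp
    finally show ?thesis by (simp add: power2_eq_square mult_ac)
  qed
  show ?thesis
  proof
    show "m / K > 0" using m K by simp
    fix \<delta> assume \<delta>: "\<bar>\<delta>\<bar> \<le> m / K"
    have "0 \<le> x \<bullet> ((A + \<delta> *\<^sub>R B) *v x)" for x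
    proof -
      have "\<bar>\<delta> * (x \<bullet> (B *v x))\<bar> \<le> (m / K) * (K * (norm x)\<^sup>2)"
        unfolding abs_mult using \<delta> B by (intro mult_mono) auto
      also have "\<dots> \<le> x \<bullet> (A *v x)"
        using m K by simp
      finally show ?thesis
        unfolding quad_form_add_scaleR by linarith
    qed
    thus "pos_semidef (A + \<delta> *\<^sub>R B)"
      using assms by (simp add: pos_semidef_def pos_def_def symmetric_matrix_add_scaleR)
  qed
qed

lemma bounded_sublevel_quad_fun:
  assumes "pos_def A"
  shows "bounded {x. quad_fun A b c x \<le> T}"
proof -
  obtain m where m: "m > 0" "\<And>x. m * (norm x)\<^sup>2 \<le> x \<bullet> (A *v x)"
    using pos_def_lower_bound[OF assms] by blast
  \<comment> \<open>The fraction makes \<open>m * norm x\<close> exceed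
    \<open>2 * norm b + \<bar>T - c\<bar>\<close> outside the ball of radius \<open>R\<close>. The
    summand 1 makes \<open>norm x\<close> exceed 1 there, so the constant
    \<open>\<bar>T - c\<bar>\<close> is dominated by its product with \<open>norm x\<close>.\<close>
  define R where "R = 1 + (2 * norm b + \<bar>T - c\<bar>) / m"
  have "norm x \<le> R" if x: "quad_fun A b c x \<le> T" for x
  proof (rule ccontr)
    assume "\<not> norm x \<le> R"
    hence R: "R < norm x" by simp
    have "(2 * norm b + \<bar>T - c\<bar>) / m \<ge> 0"
      using m by simp
    with R have 1: "norm x > 1" by (simp add: R_def)
    have "(2 * norm b + \<bar>T - c\<bar>) / m < norm x"
      using R by (simp add: R_def)
    hence "2 * norm b + \<bar>T - c\<bar> < m * norm x"
      using m by (simp add: divide_less_eq mult.commute)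
    hence "(2 * norm b + \<bar>T - c\<bar>) * norm x < m * norm x * norm x"
      using 1 by (intro mult_strict_right_mono) auto
    moreover have "\<bar>T - c\<bar> * 1 \<le> \<bar>T - c\<bar> * norm x"
      using 1 by (intro mult_left_mono) auto
    moreover have "\<bar>b \<bullet> x\<bar> \<le> norm b * norm x"
      by (rule Cauchy_Schwarz_ineq2)
    moreover have "m * norm x * norm x + 2 * (b \<bullet> x) + c \<le> T"
      using x m(2)[of x] by (simp add: quad_fun_def power2_eq_square mult.assoc)
    ultimately show False
      by (simp add: algebra_simps)
  qed
  thus ?thesis
    by (auto intro!: boundedI)
qed

text \<open>The sublevel set of \<open>f\<close> at a value it takes is closed, and bounded since it
  sits in a sublevel set of the positive definite minorant. A minimizer on it is global. Both minima
  of the theorem come from here, with the same minorant.\<close>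

lemma coercive_attains_min:
  fixes f :: "real ^ 'n \<Rightarrow> real"
  assumes "pos_def A" "closed S" "S \<noteq> {}" "continuous_on S f"
    and "\<And>x. x \<in> S \<Longrightarrow> quad_fun A b c x \<le> f x"
  obtains x where "x \<in> S" "\<And>y. y \<in> S \<Longrightarrow> f x \<le> f y"
proof -
  obtain x0 where x0: "x0 \<in> S" using assms by blast
  define L where "L = {x \<in> S. f x \<le> f x0}"
  have "L \<subseteq> {x. quad_fun A b c x \<le> f x0}"
    using assms(5) by (force simp: L_def)
  hence "bounded L"
    using bounded_sublevel_quad_fun[OF assms(1)] bounded_subset by blast
  moreover have "closed L"
    unfolding L_def by (intro continuous_on_closed_Collect_le assms continuous_intros)
  ultimately have "compact L" by (simp add: compact_eq_bounded_closed)
  moreover have "L \<noteq> {}" using x0 by (auto simp: L_def)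
  moreover have "continuous_on L f"
    by (rule continuous_on_subset[OF assms(4)]) (auto simp: L_def)
  ultimately obtain x where "x \<in> L" "\<And>y. y \<in> L \<Longrightarrow> f x \<le> f y"
    using continuous_attains_inf by metis
  thus ?thesis
    by (intro that[of x]) (force simp: L_def)+
qed

section \<open>Convexity, and splitting a point along a line\<close>

lemma convex_on_quad_fun:
  assumes "pos_semidef A"
  shows "convex_on UNIV (quad_fun A b c)"
proof (rule convex_onI)
  fix t :: real and x y :: "real ^ 'a"
  assume t: "0 < t" "t < 1"
  define z where "z = y - x"
  define d where "d = x \<bullet> (A *v z) + z \<bullet> (A *v x) + 2 * (b \<bullet> z)"
  have "(1 - t) *\<^sub>R x + t *\<^sub>R y = x + t *\<^sub>R z" "y = x + 1 *\<^sub>R z"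
    by (simp_all add: z_def algebra_simps)
  hence line: "quad_fun A b c ((1 - t) *\<^sub>R x + t *\<^sub>R y) =
        quad_fun A b c x + t * d + t\<^sup>2 * (z \<bullet> (A *v z))"
      "quad_fun A b c y = quad_fun A b c x + d + z \<bullet> (A *v z)"
    using quad_fun_along_line[of A b c x t z] quad_fun_along_line[of A b c x 1 z]
    by (simp_all add: d_def)
  \<comment> \<open>On the segment only the quadratic term deviates from linear interpolation, and
    \<open>t\<^sup>2 \<le> t\<close> for \<open>t\<close> between 0 and 1.\<close>
  have "t\<^sup>2 * (z \<bullet> (A *v z)) \<le> t * (z \<bullet> (A *v z))"
    using assms t by (intro mult_right_mono) (auto simp: pos_semidef_def power2_eq_square)
  thus "quad_fun A b c ((1 - t) *\<^sub>R x + t *\<^sub>R y)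
      \<le> (1 - t) * quad_fun A b c x + t * quad_fun A b c y"
    unfolding line by (simp add: algebra_simps)
qed simp

text \<open>Since \<open>a * c < 0\<close>, the discriminant exceeds \<open>\<beta>\<^sup>2\<close>,
  so its square root outweighs \<open>\<beta>\<close> and the two roots have opposite signs.\<close>

lemma quadratic_roots_around_zero:
  fixes a \<beta> c :: real
  assumes "a * c < 0"
  obtains r s where "r < 0" "0 < s" "c + r * \<beta> + r\<^sup>2 * a = 0" "c + s * \<beta> + s\<^sup>2 * a = 0"
proof -
  have pos: "\<exists>r s. r < 0 \<and> 0 < s \<and> c + r * \<beta> + r\<^sup>2 * a = 0 \<and> c + s * \<beta> + s\<^sup>2 * a = 0"
    if "a > 0" "c < 0" for a \<beta> c :: real
  proof -
    define d where "d = sqrt (\<beta>\<^sup>2 - 4 * a * c)"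
    have "a * c < 0"
      using that by (simp add: mult_pos_neg)
    hence D: "\<beta>\<^sup>2 < \<beta>\<^sup>2 - 4 * a * c" by simp
    hence d2: "d\<^sup>2 = \<beta>\<^sup>2 - 4 * a * c"
      unfolding d_def by (intro real_sqrt_pow2) (smt (verit) zero_le_power2)
    have "\<bar>\<beta>\<bar> < d"
      unfolding d_def using real_sqrt_less_mono[OF D] by simp
    \<comment> \<open>Both roots are checked at once, with \<open>e\<close> standing for
      \<open>d\<close> and for \<open>- d\<close>. Expressing \<open>c\<close> through
      \<open>e\<^sup>2\<close> leaves an identity of rational functions.\<close>
    moreover have "c + ((- \<beta> + e) / (2 * a)) * \<beta> + ((- \<beta> + e) / (2 * a))\<^sup>2 * a = 0"
      if "e\<^sup>2 = d\<^sup>2" for e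
    proof -
      have c: "c = (\<beta>\<^sup>2 - e\<^sup>2) / (4 * a)"
        using \<open>a > 0\<close> that[unfolded d2] by (simp add: field_simps)
      show ?thesis
        unfolding c using \<open>a > 0\<close> by (simp add: field_simps power2_eq_square)
    qed
    from this[of d] this[of "- d"]
    have "c + ((- \<beta> + d) / (2 * a)) * \<beta> + ((- \<beta> + d) / (2 * a))\<^sup>2 * a = 0"
         "c + ((- \<beta> + - d) / (2 * a)) * \<beta> + ((- \<beta> + - d) / (2 * a))\<^sup>2 * a = 0"
      by simp_all
    moreover have "(- \<beta> + - d) / (2 * a) < 0" "(- \<beta> + d) / (2 * a) > 0"
      using \<open>a > 0\<close> \<open>\<bar>\<beta>\<bar> < d\<close> by (auto simp: divide_neg_pos)
    ultimately show ?thesis by blast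
  qed
  show ?thesis
  proof (cases "a > 0")
    case True
    hence "c < 0" using assms by (simp add: mult_less_0_iff)
    thus ?thesis using pos[OF True] that by metis
  next
    case False
    hence "- a > 0" "- c < 0" using assms by (auto simp: mult_less_0_iff)
    \<comment> \<open>Negating all three coefficients leaves the roots unchanged and reduces to a
      positive leading coefficient.\<close>
    from pos[OF this, of "- \<beta>"] obtain r s where
      "r < 0" "0 < s" "- c + r * - \<beta> + r\<^sup>2 * - a = 0" "- c + s * - \<beta> + s\<^sup>2 * - a = 0" by blast
    thus ?thesis by (intro that[of r s]) auto
  qed
qed

lemma mem_hull_epi_eq_if_affine_along:
  fixes x v :: "'a :: real_vector"
  assumes le: "aggregate q0 q1 \<gamma> x \<le> t"
    and affine: "\<And>\<alpha>. aggregate q0 q1 \<gamma> (x + \<alpha> *\<^sub>R v) = aggregate q0 q1 \<gamma> x + \<alpha> * d"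
    and quadratic: "\<And>\<alpha>. q1 (x + \<alpha> *\<^sub>R v) = q1 x + \<alpha> * \<beta> + \<alpha>\<^sup>2 * a"
    and sign: "a * q1 x < 0"
  shows "(x, t) \<in> convex hull (epi_eq q0 q1)"
proof -
  obtain r s where rs: "r < 0" "0 < s" "q1 (x + r *\<^sub>R v) = 0" "q1 (x + s *\<^sub>R v) = 0"
    using quadratic_roots_around_zero[OF sign, of \<beta>] unfolding quadratic by metis
  \<comment> \<open>Where \<open>q1\<close> vanishes, \<open>q0\<close> equals the aggregate, which
    has changed by exactly \<open>\<alpha> * d\<close> from its value at \<open>x\<close>, a value
    bounded by \<open>t\<close>.\<close>
  have lift: "(x + \<alpha> *\<^sub>R v, t + \<alpha> * d) \<in> convex hull (epi_eq q0 q1)"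
    if "q1 (x + \<alpha> *\<^sub>R v) = 0" for \<alpha>
  proof (rule hull_inc)
    show "(x + \<alpha> *\<^sub>R v, t + \<alpha> * d) \<in> epi_eq q0 q1"
      using affine[of \<alpha>] le that by (simp add: epi_eq_def aggregate_def)
  qed
  \<comment> \<open>The weight for which the parameters \<open>r\<close> and \<open>s\<close>
    average to 0, so that the two lifted points average to \<open>(x, t)\<close>.\<close>
  define w where "w = s / (s - r)"
  have w: "0 \<le> w" "0 \<le> 1 - w" "w + (1 - w) = 1"
    using rs by (simp_all add: w_def)
  have mean: "w * r + (1 - w) * s = 0"
    using rs by (simp add: w_def field_simps)
  have "w *\<^sub>R (x + r *\<^sub>R v, t + r * d) + (1 - w) *\<^sub>R (x + s *\<^sub>R v, t + s * d)
      = (x + (w * r + (1 - w) * s) *\<^sub>R v, t + (w * r + (1 - w) * s) * d)"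
    by (simp add: algebra_simps)
  also have "\<dots> = (x, t)"
    by (simp add: mean)
  finally show ?thesis
    using convexD[OF convex_convex_hull lift[OF rs(3)] lift[OF rs(4)] w] by simp
qed

section \<open>The set of admissible multipliers and its extreme elements\<close>

lemma compact_psd_multipliers:
  fixes A0 A1 :: "real ^ 'n ^ 'n"
  assumes sym: "symmetric_matrix A0" "symmetric_matrix A1"
    and neg: "w \<bullet> (A1 *v w) < 0"
  shows "compact (psd_multipliers A0 A1)"
proof -
  have "psd_multipliers A0 A1 =
      {\<gamma>. 0 \<le> \<gamma>} \<inter> (\<Inter>x. {\<gamma>. 0 \<le> x \<bullet> (A0 *v x) + \<gamma> * (x \<bullet> (A1 *v x))})"
    using sym by (auto simp: psd_multipliers_def pos_semidef_def quad_form_add_scaleR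
        symmetric_matrix_add_scaleR)
  moreover have "closed {\<gamma>. 0 \<le> x \<bullet> (A0 *v x) + \<gamma> * (x \<bullet> (A1 *v x))}" for x
    by (intro closed_Collect_le continuous_intros)
  ultimately have "closed (psd_multipliers A0 A1)"
    by (auto intro!: closed_Int closed_INT closed_Collect_le continuous_intros)
  \<comment> \<open>Along \<open>w\<close> the aggregated form decreases linearly in the multiplier;
    the upper end is where it reaches 0.\<close>
  moreover have "psd_multipliers A0 A1 \<subseteq> {0 .. (w \<bullet> (A0 *v w)) / - (w \<bullet> (A1 *v w))}"
  proof
    fix \<gamma> assume \<gamma>: "\<gamma> \<in> psd_multipliers A0 A1"
    hence "0 \<le> w \<bullet> (A0 *v w) + \<gamma> * (w \<bullet> (A1 *v w))"
      by (auto simp: psd_multipliers_def pos_semidef_def simp flip: quad_form_add_scaleR)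
    hence "\<gamma> * - (w \<bullet> (A1 *v w)) \<le> w \<bullet> (A0 *v w)"
      by simp
    hence "\<gamma> \<le> (w \<bullet> (A0 *v w)) / - (w \<bullet> (A1 *v w))"
      using neg by (subst pos_le_divide_eq) auto
    thus "\<gamma> \<in> {0 .. (w \<bullet> (A0 *v w)) / - (w \<bullet> (A1 *v w))}"
      using \<gamma> by (simp add: psd_multipliers_def)
  qed
  ultimately show ?thesis
    by (meson bounded_closed_interval bounded_subset compact_eq_bounded_closed)
qed

text \<open>Without an isotropic vector the form would be positive definite at
  \<open>\<gamma>\<close>, and the multiplier could be moved both up and down, contradicting either
  kind of extremality.\<close>

lemma extreme_multiplier_isotropic:
  fixes A0 A1 :: "real ^ 'n ^ 'n"
  assumes "symmetric_matrix A1" and mem: "\<gamma> \<in> psd_multipliers A0 A1" and "\<gamma> > 0"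
    and extreme: "(\<forall>\<delta>\<in>psd_multipliers A0 A1. \<gamma> \<le> \<delta>) \<or> (\<forall>\<delta>\<in>psd_multipliers A0 A1. \<delta> \<le> \<gamma>)"
  obtains v where "v \<noteq> 0" "v \<bullet> ((A0 + \<gamma> *\<^sub>R A1) *v v) = 0"
proof (rule ccontr)
  assume "\<not> thesis"
  hence "pos_def (A0 + \<gamma> *\<^sub>R A1)"
    using mem that unfolding psd_multipliers_def pos_semidef_def pos_def_def
    by (metis (mono_tags, lifting) mem_Collect_eq order_le_less)
  then obtain e where e: "e > 0" "\<And>\<delta>. \<bar>\<delta>\<bar> \<le> e \<Longrightarrow> pos_semidef (A0 + \<gamma> *\<^sub>R A1 + \<delta> *\<^sub>R A1)"
    using pos_semidef_perturbation[OF _ assms(1)] by blast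
  \<comment> \<open>Capping at \<open>\<gamma>\<close> keeps \<open>\<gamma> - \<delta>\<close>
    nonnegative, as membership among the multipliers demands.\<close>
  define \<delta> where "\<delta> = min e \<gamma>"
  have \<delta>: "\<delta> > 0" "\<delta> \<le> e" "\<delta> \<le> \<gamma>"
    using e \<open>\<gamma> > 0\<close> by (simp_all add: \<delta>_def)
  have "\<gamma> + \<delta> \<in> psd_multipliers A0 A1" "\<gamma> + - \<delta> \<in> psd_multipliers A0 A1"
    using e(2)[of \<delta>] e(2)[of "- \<delta>"] \<delta> \<open>\<gamma> > 0\<close>
    by (simp_all add: psd_multipliers_def scaleR_add_left scaleR_diff_left add.assoc add_diff_eq)
  thus False
    using extreme \<delta>(1) by fastforce
qed

lemma convex_epi_aggregate_quad_fun:
  assumes "pos_semidef (A0 + \<gamma> *\<^sub>R A1)"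
  shows "convex (epi_aggregate (quad_fun A0 b0 c0) (quad_fun A1 b1 c1) \<gamma>)"
proof -
  have "epi_aggregate (quad_fun A0 b0 c0) (quad_fun A1 b1 c1) \<gamma> =
      epigraph UNIV (aggregate (quad_fun A0 b0 c0) (quad_fun A1 b1 c1) \<gamma>)"
    by (auto simp: epi_aggregate_def epigraph_def)
  thus ?thesis
    using convex_on_quad_fun[OF assms] by (simp add: aggregate_quad_fun convex_epigraph)
qed

theorem theorem1:
  fixes A0 A1 :: "real ^ 'n ^ 'n" and b0 b1 :: "real ^ 'n" and c0 c1 :: real
    and q0 q1 :: "real ^ 'n \<Rightarrow> real"
  assumes "symmetric_matrix A0" and "symmetric_matrix A1"
    and "q0 = quad_fun A0 b0 c0" and "q1 = quad_fun A1 b1 c1"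
    and "\<exists>l<0. eigenvalue A0 l" and "\<exists>l<0. eigenvalue A1 l"
    and "\<exists>\<gamma>\<ge>0. pos_def (A0 + \<gamma> *\<^sub>R A1)"
  shows "\<exists>\<gamma>m \<gamma>p.
      (\<gamma>m \<in> psd_multipliers A0 A1 \<and> (\<forall>\<gamma>\<in>psd_multipliers A0 A1. \<gamma>m \<le> \<gamma>)) \<and>
      (\<gamma>p \<in> psd_multipliers A0 A1 \<and> (\<forall>\<gamma>\<in>psd_multipliers A0 A1. \<gamma> \<le> \<gamma>p)) \<and>
      convex hull (epi_le q0 q1) = convex hull (epi_eq q0 q1) \<and>
      convex hull (epi_eq q0 q1) = epi_aggregate q0 q1 \<gamma>m \<inter> epi_aggregate q0 q1 \<gamma>p \<and>
      (\<exists>x y. is_arg_min q0 (\<lambda>x. q1 x \<le> 0) x \<and>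
             is_arg_min (\<lambda>y. max (aggregate q0 q1 \<gamma>m y) (aggregate q0 q1 \<gamma>p y)) (\<lambda>_. True) y \<and>
             q0 x = max (aggregate q0 q1 \<gamma>m y) (aggregate q0 q1 \<gamma>p y))"
proof -

  \<comment> \<open>Extreme multipliers, their isotropic directions, and the hulls\<close>
  let ?\<Gamma> = "psd_multipliers A0 A1"
  note q = assms(3,4)
  obtain g where g: "g \<ge> 0" "pos_def (A0 + g *\<^sub>R A1)"
    using assms(7) by blast
  have "g \<in> ?\<Gamma>"
    using g by (simp add: psd_multipliers_def pos_def_imp_pos_semidef)
  obtain u where u: "u \<bullet> (A0 *v u) < 0"
    using assms(5) negative_eigenvalue_negative_direction by blast
  obtain w where w: "w \<bullet> (A1 *v w) < 0"
    using assms(6) negative_eigenvalue_negative_direction by blast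
  have "compact ?\<Gamma>" "?\<Gamma> \<noteq> {}"
    using compact_psd_multipliers[OF assms(1,2) w] \<open>g \<in> ?\<Gamma>\<close> by auto
  then obtain \<gamma>m \<gamma>p where m: "\<gamma>m \<in> ?\<Gamma>" "\<forall>\<gamma>\<in>?\<Gamma>. \<gamma>m \<le> \<gamma>" and p: "\<gamma>p \<in> ?\<Gamma>" "\<forall>\<gamma>\<in>?\<Gamma>. \<gamma> \<le> \<gamma>p"
    using compact_attains_inf compact_attains_sup by metis
  \<comment> \<open>This is where the negative eigenvalue of \<open>A0\<close> enters: it forces
    both extreme multipliers to be positive.\<close>
  have "0 \<notin> ?\<Gamma>"
    using u by (auto simp: psd_multipliers_def pos_semidef_def not_le)
  hence pos: "0 < \<gamma>m" "0 < \<gamma>p"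
    using m(1) p(1) by (auto simp: psd_multipliers_def order_le_less)
  have "\<gamma>m \<le> g" "g \<le> \<gamma>p"
    using m p \<open>g \<in> ?\<Gamma>\<close> by auto

  \<comment> \<open>The form at \<open>g\<close> is the form at \<open>\<gamma>\<close> plus
    \<open>g - \<gamma>\<close> times that of \<open>A1\<close>. At an isotropic vector for
    \<open>\<gamma>\<close> only the second term remains, and it must be positive. So the side of
    \<open>g\<close> on which \<open>\<gamma>\<close> lies decides the sign of the \<open>A1\<close>
    form.\<close>
  have slope: "(g - \<gamma>) * (v \<bullet> (A1 *v v)) > 0"
    if "v \<noteq> 0" "v \<bullet> ((A0 + \<gamma> *\<^sub>R A1) *v v) = 0" for \<gamma> v
  proof -
    have "v \<bullet> ((A0 + g *\<^sub>R A1) *v v) > 0"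
      using g that by (simp add: pos_def_def)
    thus ?thesis
      using that(2) unfolding quad_form_add_scaleR by (simp add: algebra_simps)
  qed
  obtain v where v: "v \<noteq> 0" "v \<bullet> ((A0 + \<gamma>m *\<^sub>R A1) *v v) = 0"
    using extreme_multiplier_isotropic[OF assms(2) m(1) pos(1)] m(2) by blast
  obtain z where z: "z \<noteq> 0" "z \<bullet> ((A0 + \<gamma>p *\<^sub>R A1) *v z) = 0"
    using extreme_multiplier_isotropic[OF assms(2) p(1) pos(2)] p(2) by blast
  have v1: "v \<bullet> (A1 *v v) > 0"
    using slope[OF v] \<open>\<gamma>m \<le> g\<close> by (auto simp: zero_less_mult_iff)
  have z1: "z \<bullet> (A1 *v z) < 0"
    using slope[OF z] \<open>g \<le> \<gamma>p\<close> by (auto simp: zero_less_mult_iff)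

  have hull_step: "(x, t) \<in> convex hull (epi_eq q0 q1)"
    if "y \<bullet> ((A0 + \<gamma> *\<^sub>R A1) *v y) = 0" "aggregate q0 q1 \<gamma> x \<le> t" "(y \<bullet> (A1 *v y)) * q1 x < 0"
    for x t y \<gamma>
    using that(2) _ _ that(3)
  proof (rule mem_hull_epi_eq_if_affine_along)
    show "aggregate q0 q1 \<gamma> (x + \<alpha> *\<^sub>R y) = aggregate q0 q1 \<gamma> x + \<alpha> *
        (x \<bullet> ((A0 + \<gamma> *\<^sub>R A1) *v y) + y \<bullet> ((A0 + \<gamma> *\<^sub>R A1) *v x) + 2 * ((b0 + \<gamma> *\<^sub>R b1) \<bullet> y))" for \<alpha>
      \<comment> \<open>Isotropy of \<open>y\<close> removes the term in
        \<open>\<alpha>\<^sup>2\<close>.\<close>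
      unfolding q aggregate_quad_fun quad_fun_along_line that(1) by simp
    show "q1 (x + \<alpha> *\<^sub>R y) = q1 x + \<alpha> *
        (x \<bullet> (A1 *v y) + y \<bullet> (A1 *v x) + 2 * (b1 \<bullet> y)) + \<alpha>\<^sup>2 * (y \<bullet> (A1 *v y))" for \<alpha>
      unfolding q by (rule quad_fun_along_line)
  qed
  have sup: "epi_aggregate q0 q1 \<gamma>m \<inter> epi_aggregate q0 q1 \<gamma>p \<subseteq> convex hull (epi_eq q0 q1)"
  proof clarify
    fix x t
    assume "(x, t) \<in> epi_aggregate q0 q1 \<gamma>m" "(x, t) \<in> epi_aggregate q0 q1 \<gamma>p"
    hence le: "aggregate q0 q1 \<gamma>m x \<le> t" "aggregate q0 q1 \<gamma>p x \<le> t"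
      by (simp_all add: epi_aggregate_def)
    consider "q1 x = 0" | "q1 x < 0" | "q1 x > 0" by linarith
    thus "(x, t) \<in> convex hull (epi_eq q0 q1)"
    proof cases
      case 1
      thus ?thesis
        using le by (intro hull_inc) (simp add: epi_eq_def aggregate_def)
    next
      case 2
      thus ?thesis
        using hull_step[OF v(2) le(1)] v1 by (simp add: mult_pos_neg)
    next
      case 3
      thus ?thesis
        using hull_step[OF z(2) le(2)] z1 by (simp add: mult_neg_pos)
    qed
  qed
  have agg_le: "aggregate q0 q1 \<gamma> x \<le> q0 x" if "\<gamma> \<ge> 0" "q1 x \<le> 0" for \<gamma> x
    using that by (simp add: aggregate_def mult_nonneg_nonpos)
  have "epi_le q0 q1 \<subseteq> epi_aggregate q0 q1 \<gamma>m \<inter> epi_aggregate q0 q1 \<gamma>p"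
    using pos by (auto simp: epi_le_def epi_aggregate_def intro: order_trans[OF agg_le])
  moreover have "convex (epi_aggregate q0 q1 \<gamma>m \<inter> epi_aggregate q0 q1 \<gamma>p)"
    using m(1) p(1) unfolding q psd_multipliers_def
    by (intro convex_Int convex_epi_aggregate_quad_fun) auto
  ultimately have sub: "convex hull (epi_le q0 q1) \<subseteq> epi_aggregate q0 q1 \<gamma>m \<inter> epi_aggregate q0 q1 \<gamma>p"
    by (rule hull_minimal)
  have eq_le: "convex hull (epi_eq q0 q1) \<subseteq> convex hull (epi_le q0 q1)"
    by (rule hull_mono) (auto simp: epi_eq_def epi_le_def)
  have hulls: "convex hull (epi_le q0 q1) = convex hull (epi_eq q0 q1)"
      "convex hull (epi_eq q0 q1) = epi_aggregate q0 q1 \<gamma>m \<inter> epi_aggregate q0 q1 \<gamma>p"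
    using sub eq_le sup by blast+

  \<comment> \<open>Attainment and equality of the two minima\<close>
  define F where "F = (\<lambda>y. max (aggregate q0 q1 \<gamma>m y) (aggregate q0 q1 \<gamma>p y))"
  let ?G = "quad_fun (A0 + g *\<^sub>R A1) (b0 + g *\<^sub>R b1) (c0 + g * c1)"
  have G: "?G = aggregate q0 q1 g"
    by (simp add: q aggregate_quad_fun)
  \<comment> \<open>The aggregate is affine in the multiplier and \<open>g\<close> lies between
    \<open>\<gamma>m\<close> and \<open>\<gamma>p\<close>, so its value at \<open>g\<close> is at
    most the larger endpoint value. This gives \<open>F\<close> a coercive minorant.\<close>
  have G_le_F: "?G y \<le> F y" for y
    using \<open>\<gamma>m \<le> g\<close> \<open>g \<le> \<gamma>p\<close> mult_right_mono[of g \<gamma>p "q1 y"] mult_right_mono_neg[of \<gamma>m g "q1 y"]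
    unfolding G F_def aggregate_def by (cases "q1 y \<ge> 0") auto
  have "continuous_on UNIV F"
    unfolding F_def q aggregate_quad_fun by (intro continuous_intros)
  then obtain y where y: "\<And>y'. F y \<le> F y'"
    using coercive_attains_min[OF g(2) closed_UNIV _ _ G_le_F] by auto
  \<comment> \<open>Used twice: a nonempty hull yields a feasible point for
    \<open>q1 x \<le> 0\<close>, and any lower bound for \<open>t\<close> on the hull applies to
    \<open>F y\<close>.\<close>
  have y_hull: "(y, F y) \<in> convex hull (epi_le q0 q1)"
    unfolding hulls by (simp add: F_def epi_aggregate_def)

  have "closed {x. q1 x \<le> 0}"
    unfolding q by (intro closed_Collect_le continuous_intros)
  moreover have "{x. q1 x \<le> 0} \<noteq> {}"
  proof
    assume "{x. q1 x \<le> 0} = {}"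
    hence "epi_le q0 q1 = {}"
      by (auto simp: epi_le_def)
    thus False using y_hull by simp
  qed
  moreover have "continuous_on {x. q1 x \<le> 0} q0"
    unfolding q by (intro continuous_intros)
  moreover have "?G x \<le> q0 x" if "x \<in> {x. q1 x \<le> 0}" for x
    using agg_le[OF g(1)] that unfolding G by simp
  ultimately obtain x where x: "q1 x \<le> 0" "\<And>x'. q1 x' \<le> 0 \<Longrightarrow> q0 x \<le> q0 x'"
    using coercive_attains_min[OF g(2)] by (metis mem_Collect_eq)
  \<comment> \<open>The half-space is convex, so passing to the hull does not lower the infimum of
    \<open>t\<close> below \<open>q0 x\<close>. This gives \<open>q0 x \<le> F y\<close>; the
    converse is weak duality at \<open>x\<close> together with minimality of
    \<open>y\<close>.\<close>
  have "epi_le q0 q1 \<subseteq> UNIV \<times> {q0 x..}"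
    using x(2) by (force simp: epi_le_def)
  hence "convex hull (epi_le q0 q1) \<subseteq> UNIV \<times> {q0 x..}"
    by (intro hull_minimal convex_Times) auto
  hence "q0 x \<le> F y"
    using y_hull by auto
  moreover have "F x \<le> q0 x"
    using agg_le x(1) pos by (simp add: F_def)
  ultimately have "q0 x = F y"
    using y[of x] by simp
  moreover have "is_arg_min q0 (\<lambda>x. q1 x \<le> 0) x" "is_arg_min F (\<lambda>_. True) y"
    using x y by (auto simp: is_arg_min_linorder)
  ultimately show ?thesis
    using m p hulls unfolding F_def by blast
qed

end
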